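(* Suppose that $n\ge4$. Then $(F_n^k,F_n^{k-1})$ is a dual pair of alternating sign matrices for $3\le k\le n-1$. Consequently the discrete imprecise copulas $\left(Q(F_n^{n-1}),Q(F_n^{n-2})\right)$, $\left(Q(F_n^{n-2}),Q(F_n^{n-3})\right)$, $\ldots$, $\left(Q(F_n^{3}),Q(F_n^{2})\right)$ form a maximal chain of self-dual discrete imprecise copulas; that is, with $l=n-2$ and $Q_r=Q(F_n^{n-r})$, $\{Q_r\}_{r=1}^l$ is a sequence of proper discrete quasi-copulas such that $(Q_r)_O=Q_{r-1}$ for $r=2,3,\ldots,l$ and $(Q_r)_M=Q_{r+1}$ for $r=1,2,\ldots,l-1$, and this chain cannot be extended further since $Q(F_n^{n-1})_O=W_n$ and $Q(F_n^2)_M=M_n$, which are discrete copulas (not proper quasi-copulas).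
   Context: Let $L_n=\{0,1,\dots,n\}$. A function $Q:L_n^2\to[0,n]$ is a discrete quasi-copula if (Q1') $Q(r,0)=Q(0,s)=0$, $Q(r,n)=r$, $Q(n,s)=s$ for all $r,s\in L_n$; (Q2') $Q$ is nondecreasing in each variable; (Q3') $|Q(r_2,s_2)-Q(r_1,s_1)|\le|r_2-r_1|+|s_2-s_1|$. For $R=[i,j]\times[k,l]$ with $0\le i\le j\le n$, $0\le k\le l\le n$, $V_Q(R)=Q(i,k)+Q(j,l)-Q(i,l)-Q(j,k)$. $Q$ is a discrete copula if (Q1') holds and $V_Q(R)\ge0$ for all $R$; a discrete quasi-copula is proper if $V_Q(R)<0$ for some $R$. $M_n(r,s)=\min\{r,s\}$ and $W_n(r,s)=\max\{0,r+s-n\}$ are the discrete Fréchet bounds. An alternating sign matrix (ASM) of size $n$ is an $n\times n$ matrix with entries in $\{-1,0,1\}$ such that all initial partial sums along rows and columns lie in $[0,1]$ and all row and column sums equal $1$. For an ASM $A=[a_{ij}]$, $Q(A)(r,s)=\sum_{i=1}^r\sum_{j=1}^s a_{ij}$ (zero if $r=0$ or $s=0$) is a discrete quasi-copula. For $1\le k\le n$, $F_n^k$ is the ASM with $(F_n^k)_{ij}=(-1)^{i+j-k-1}$ if $k+1\le i+j\le2n-k+1$ and $|i-j|\le k-1$, and $0$ otherwise (so $F_n^1$ is the identity and $F_n^n$ the anti-identity matrix). Defects: for $(r,s)\in L_n^2$, $D^Q_{\searrow}(r,s)=\min_{r'\ge r,s'\ge s}V_Q([r,r']\times[s,s'])$,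 $D^Q_{\nwarrow}(r,s)=\min_{r'\le r,s'\le s}V_Q([r',r]\times[s',s])$, $D^Q_{\swarrow}(r,s)=\min_{r'\ge r,s'\le s}V_Q([r,r']\times[s',s])$, $D^Q_{\nearrow}(r,s)=\min_{r'\le r,s'\ge s}V_Q([r',r]\times[s,s'])$, where $r',s'\in L_n$ (degenerate rectangles contribute $0$). $D_M^Q=\min\{D^Q_{\searrow},D^Q_{\nwarrow}\}$, $D_O^Q=\min\{D^Q_{\swarrow},D^Q_{\nearrow}\}$, $Q_M=Q-D_M^Q$, $Q_O=Q+D_O^Q$. A pair $(P,Q)$ of functions $L_n^2\to[0,n]$ is a discrete imprecise copula if both satisfy (Q1') and for every rectangle $[i,j]\times[k,l]$ with integers $0\le i\le j\le n$ and $0\le k\le l\le n$: $Q(i,k)+P(j,l)-P(i,l)-P(j,k)\ge0$, $P(i,k)+Q(j,l)-P(i,l)-P(j,k)\ge0$, $Q(i,k)+Q(j,l)-Q(i,l)-P(j,k)\ge0$, $Q(i,k)+Q(j,l)-P(i,l)-Q(j,k)\ge0$; it is also assumed that $P$ and $Q$ are proper quasi-copulas. It is self-dual if $P_M=Q$ and $Q_O=P$. A pair $(A,B)$ of ASMs is a dual pair if $(Q(A),Q(B))$ is a self-dual discrete imprecise copula. *)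

theory Defs
  imports Complex_Main
begin

text \<open>
  A function on the grid \<open>L n \<times> L n\<close> is represented by a total function
  \<^typ>\<open>nat \<Rightarrow> nat \<Rightarrow> real\<close> of which only the values at arguments \<open>\<le> n\<close> are relevant;
  equality of such functions is therefore \<open>grid_eq\<close>. An \<open>n \<times> n\<close> matrix is
  represented by a function \<^typ>\<open>nat \<Rightarrow> nat \<Rightarrow> int\<close> with indices in \<open>{1..n}\<close>.
\<close>

definition L :: "nat \<Rightarrow> nat set" where
  "L n = {0..n}"

definition grid_eq :: "nat \<Rightarrow> (nat \<Rightarrow> nat \<Rightarrow> real) \<Rightarrow> (nat \<Rightarrow> nat \<Rightarrow> real) \<Rightarrow> bool" where
  "grid_eq n P Q \<longleftrightarrow> (\<forall>r\<in>L n. \<forall>s\<in>L n. P r s = Q r s)"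

definition grid_function :: "nat \<Rightarrow> (nat \<Rightarrow> nat \<Rightarrow> real) \<Rightarrow> bool" where
  "grid_function n Q \<longleftrightarrow> (\<forall>r\<in>L n. \<forall>s\<in>L n. 0 \<le> Q r s \<and> Q r s \<le> real n)"

definition boundary :: "nat \<Rightarrow> (nat \<Rightarrow> nat \<Rightarrow> real) \<Rightarrow> bool" where
  "boundary n Q \<longleftrightarrow>
     (\<forall>r\<in>L n. Q r 0 = 0 \<and> Q r n = real r) \<and>
     (\<forall>s\<in>L n. Q 0 s = 0 \<and> Q n s = real s)"

definition discrete_quasi_copula :: "nat \<Rightarrow> (nat \<Rightarrow> nat \<Rightarrow> real) \<Rightarrow> bool" where
  "discrete_quasi_copula n Q \<longleftrightarrow>
     grid_function n Q \<and> boundary n Q \<and>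
     (\<forall>s\<in>L n. \<forall>r1\<in>L n. \<forall>r2\<in>L n. r1 \<le> r2 \<longrightarrow> Q r1 s \<le> Q r2 s) \<and>
     (\<forall>r\<in>L n. \<forall>s1\<in>L n. \<forall>s2\<in>L n. s1 \<le> s2 \<longrightarrow> Q r s1 \<le> Q r s2) \<and>
     (\<forall>r1\<in>L n. \<forall>r2\<in>L n. \<forall>s1\<in>L n. \<forall>s2\<in>L n.
        \<bar>Q r2 s2 - Q r1 s1\<bar> \<le> \<bar>real r2 - real r1\<bar> + \<bar>real s2 - real s1\<bar>)"

text \<open>\<open>vol Q i j k l\<close> is the volume of \<open>[i,j] \<times> [k,l]\<close>.\<close>

definition vol :: "(nat \<Rightarrow> nat \<Rightarrow> real) \<Rightarrow> nat \<Rightarrow> nat \<Rightarrow> nat \<Rightarrow> nat \<Rightarrow> real" where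
  "vol Q i j k l = Q i k + Q j l - Q i l - Q j k"

definition discrete_copula :: "nat \<Rightarrow> (nat \<Rightarrow> nat \<Rightarrow> real) \<Rightarrow> bool" where
  "discrete_copula n Q \<longleftrightarrow>
     grid_function n Q \<and> boundary n Q \<and>
     (\<forall>i j k l. i \<le> j \<and> j \<le> n \<and> k \<le> l \<and> l \<le> n \<longrightarrow> vol Q i j k l \<ge> 0)"

definition proper_quasi_copula :: "nat \<Rightarrow> (nat \<Rightarrow> nat \<Rightarrow> real) \<Rightarrow> bool" where
  "proper_quasi_copula n Q \<longleftrightarrow>
     discrete_quasi_copula n Q \<and>
     (\<exists>i j k l. i \<le> j \<and> j \<le> n \<and> k \<le> l \<and> l \<le> n \<and> vol Q i j k l < 0)"

definition frechet_M :: "nat \<Rightarrow> nat \<Rightarrow> nat \<Rightarrow> real" where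
  "frechet_M n r s = min (real r) (real s)"

definition frechet_W :: "nat \<Rightarrow> nat \<Rightarrow> nat \<Rightarrow> real" where
  "frechet_W n r s = max 0 (real r + real s - real n)"

definition ASM :: "nat \<Rightarrow> (nat \<Rightarrow> nat \<Rightarrow> int) \<Rightarrow> bool" where
  "ASM n A \<longleftrightarrow>
     (\<forall>i\<in>{1..n}. \<forall>j\<in>{1..n}. A i j \<in> {-1, 0, 1}) \<and>
     (\<forall>i\<in>{1..n}. \<forall>m\<in>{1..n}. (\<Sum>j=1..m. A i j) \<in> {0..1}) \<and>
     (\<forall>j\<in>{1..n}. \<forall>m\<in>{1..n}. (\<Sum>i=1..m. A i j) \<in> {0..1}) \<and>
     (\<forall>i\<in>{1..n}. (\<Sum>j=1..n. A i j) = 1) \<and>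
     (\<forall>j\<in>{1..n}. (\<Sum>i=1..n. A i j) = 1)"

definition Q_of :: "(nat \<Rightarrow> nat \<Rightarrow> int) \<Rightarrow> nat \<Rightarrow> nat \<Rightarrow> real" where
  "Q_of A r s = real_of_int (\<Sum>i=1..r. \<Sum>j=1..s. A i j)"

text \<open>
  The truncated subtractions below are harmless for \<open>1 \<le> k \<le> n\<close>: in the first branch
  \<open>i + j - k - 1\<close> is the true difference, and \<open>2 * n - k + 1\<close> never truncates.
\<close>

definition F :: "nat \<Rightarrow> nat \<Rightarrow> nat \<Rightarrow> nat \<Rightarrow> int" where
  "F n k i j =
     (if k + 1 \<le> i + j \<and> i + j \<le> 2 * n - k + 1 \<and> \<bar>int i - int j\<bar> \<le> int k - 1
      then (-1) ^ (i + j - k - 1) else 0)"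

definition D_SE :: "nat \<Rightarrow> (nat \<Rightarrow> nat \<Rightarrow> real) \<Rightarrow> nat \<Rightarrow> nat \<Rightarrow> real" where
  "D_SE n Q r s = Min ((\<lambda>(r', s'). vol Q r r' s s') ` ({r..n} \<times> {s..n}))"

definition D_NW :: "nat \<Rightarrow> (nat \<Rightarrow> nat \<Rightarrow> real) \<Rightarrow> nat \<Rightarrow> nat \<Rightarrow> real" where
  "D_NW n Q r s = Min ((\<lambda>(r', s'). vol Q r' r s' s) ` ({0..r} \<times> {0..s}))"

definition D_SW :: "nat \<Rightarrow> (nat \<Rightarrow> nat \<Rightarrow> real) \<Rightarrow> nat \<Rightarrow> nat \<Rightarrow> real" where
  "D_SW n Q r s = Min ((\<lambda>(r', s'). vol Q r r' s' s) ` ({r..n} \<times> {0..s}))"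

definition D_NE :: "nat \<Rightarrow> (nat \<Rightarrow> nat \<Rightarrow> real) \<Rightarrow> nat \<Rightarrow> nat \<Rightarrow> real" where
  "D_NE n Q r s = Min ((\<lambda>(r', s'). vol Q r' r s s') ` ({0..r} \<times> {s..n}))"

definition D_M :: "nat \<Rightarrow> (nat \<Rightarrow> nat \<Rightarrow> real) \<Rightarrow> nat \<Rightarrow> nat \<Rightarrow> real" where
  "D_M n Q r s = min (D_SE n Q r s) (D_NW n Q r s)"

definition D_O :: "nat \<Rightarrow> (nat \<Rightarrow> nat \<Rightarrow> real) \<Rightarrow> nat \<Rightarrow> nat \<Rightarrow> real" where
  "D_O n Q r s = min (D_SW n Q r s) (D_NE n Q r s)"

definition Q_M :: "nat \<Rightarrow> (nat \<Rightarrow> nat \<Rightarrow> real) \<Rightarrow> nat \<Rightarrow> nat \<Rightarrow> real" where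
  "Q_M n Q r s = Q r s - D_M n Q r s"

definition Q_O :: "nat \<Rightarrow> (nat \<Rightarrow> nat \<Rightarrow> real) \<Rightarrow> nat \<Rightarrow> nat \<Rightarrow> real" where
  "Q_O n Q r s = Q r s + D_O n Q r s"

definition discrete_imprecise_copula ::
    "nat \<Rightarrow> (nat \<Rightarrow> nat \<Rightarrow> real) \<Rightarrow> (nat \<Rightarrow> nat \<Rightarrow> real) \<Rightarrow> bool" where
  "discrete_imprecise_copula n P Q \<longleftrightarrow>
     grid_function n P \<and> grid_function n Q \<and> boundary n P \<and> boundary n Q \<and>
     (\<forall>i j k l. i \<le> j \<and> j \<le> n \<and> k \<le> l \<and> l \<le> n \<longrightarrow>
        Q i k + P j l - P i l - P j k \<ge> 0 \<and>
        P i k + Q j l - P i l - P j k \<ge> 0 \<and>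
        Q i k + Q j l - Q i l - P j k \<ge> 0 \<and>
        Q i k + Q j l - P i l - Q j k \<ge> 0) \<and>
     proper_quasi_copula n P \<and> proper_quasi_copula n Q"

definition self_dual_imprecise_copula ::
    "nat \<Rightarrow> (nat \<Rightarrow> nat \<Rightarrow> real) \<Rightarrow> (nat \<Rightarrow> nat \<Rightarrow> real) \<Rightarrow> bool" where
  "self_dual_imprecise_copula n P Q \<longleftrightarrow>
     discrete_imprecise_copula n P Q \<and> grid_eq n (Q_M n P) Q \<and> grid_eq n (Q_O n Q) P"

definition dual_pair :: "nat \<Rightarrow> (nat \<Rightarrow> nat \<Rightarrow> int) \<Rightarrow> (nat \<Rightarrow> nat \<Rightarrow> int) \<Rightarrow> bool" where
  "dual_pair n A B \<longleftrightarrow> ASM n A \<and> ASM n B \<and> self_dual_imprecise_copula n (Q_of A) (Q_of B)"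

text \<open>
  A chain of length \<open>l\<close> is the sequence \<open>Q 1, \<dots>, Q l\<close>; values of \<open>Q\<close> at other indices are
  irrelevant. A chain is maximal if it is not a contiguous part of a longer chain.
\<close>

definition self_dual_chain :: "nat \<Rightarrow> nat \<Rightarrow> (nat \<Rightarrow> nat \<Rightarrow> nat \<Rightarrow> real) \<Rightarrow> bool" where
  "self_dual_chain n l Q \<longleftrightarrow>
     (\<forall>r\<in>{1..l}. proper_quasi_copula n (Q r)) \<and>
     (\<forall>r\<in>{2..l}. grid_eq n (Q_O n (Q r)) (Q (r - 1))) \<and>
     (\<forall>r\<in>{1..<l}. grid_eq n (Q_M n (Q r)) (Q (r + 1)))"

definition maximal_self_dual_chain :: "nat \<Rightarrow> nat \<Rightarrow> (nat \<Rightarrow> nat \<Rightarrow> nat \<Rightarrow> real) \<Rightarrow> bool" where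
  "maximal_self_dual_chain n l Q \<longleftrightarrow>
     self_dual_chain n l Q \<and>
     \<not> (\<exists>l' d Q'. l < l' \<and> d + l \<le> l' \<and> self_dual_chain n l' Q' \<and>
          (\<forall>r\<in>{1..l}. grid_eq n (Q' (d + r)) (Q r)))"

end

theory Submission
  imports Defs
begin

text \<open>
  The function \<open>Q(F_n^k)\<close> equals \<open>max (W_n, min (M_n, \<lceil>(r + s - k) / 2\<rceil>))\<close>, which is \<open>\<lceil>C / 2\<rceil>\<close>
  for the function \<open>C\<close> below. As \<open>C\<close> is 2-increasing, the rounding is the only source of negative
  volume: volumes are at least \<open>-1\<close>, and a south-east or north-west defect \<open>-1\<close> at \<open>(r, s)\<close> occurs
  exactly at the inner points with \<open>r + s - k\<close> even, where the ceilings for \<open>k\<close> and \<open>k - 1\<close> differ.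
  Hence \<open>Q(F_n^k)_M = Q(F_n^(k-1))\<close>. The reflection \<open>Q(r, s) \<mapsto> s - Q(n - r, s)\<close> exchanges
  the two kinds of defects and maps \<open>F_n^k\<close> to \<open>F_n^(n+1-k)\<close>, which gives \<open>Q(F_n^k)_O = Q(F_n^(k+1))\<close>.
\<close>

text \<open>
  On the grid this is \<open>max (2 W_n) (min (2 M_n) (r + s - k))\<close>. In the variables
  \<open>u = r + s\<close> and \<open>v = r - s\<close> the subtracted term is the minimum of a concave function of \<open>u\<close>
  and a convex function of \<open>v\<close>, which makes \<open>C\<close> 2-increasing.
\<close>

definition C :: "int \<Rightarrow> int \<Rightarrow> int \<Rightarrow> int \<Rightarrow> int" where
  "C n k r s = r + s - min (n - \<bar>r + s - n\<bar>) (max \<bar>r - s\<bar> k)"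

definition G :: "int \<Rightarrow> int \<Rightarrow> int \<Rightarrow> int \<Rightarrow> int" where
  "G n k r s = (C n k r s + 1) div 2"

section \<open>Symmetries, parity and monotonicity of \<open>G\<close>\<close>

lemma G_commute: "G n k r s = G n k s r"
  by (simp add: G_def C_def add.commute abs_minus_commute)

lemma G_0_left: "0 \<le> s \<Longrightarrow> s \<le> n \<Longrightarrow> G n k 0 s = 0"
  by (simp add: G_def C_def)

lemma G_n_left: "0 \<le> s \<Longrightarrow> s \<le> n \<Longrightarrow> G n k n s = s"
  by (simp add: G_def C_def)

lemma G_0_right: "0 \<le> r \<Longrightarrow> r \<le> n \<Longrightarrow> G n k r 0 = 0"
  using G_0_left G_commute by metis

lemma G_n_right: "0 \<le> r \<Longrightarrow> r \<le> n \<Longrightarrow> G n k r n = r"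
  using G_n_left G_commute by metis

lemma G_reflect: "G n k (n - r) (n - s) = n - r - s + G n k r s"
proof -
  have "C n k (n - r) (n - s) = 2 * (n - r - s) + C n k r s"
    unfolding C_def by (simp add: abs_minus_commute algebra_simps)
  then show ?thesis unfolding G_def by presburger
qed

text \<open>Outside the band where \<open>k\<close> is selected both levels have the same even
  value. Inside it \<open>C\<close> drops by 1 from \<open>k\<close> to \<open>k + 1\<close>, which
  turns rounding up into rounding down.\<close>

lemma C_div_2: "C n k r s div 2 = G n (k + 1) r s"
proof -
  define a b where "a = n - \<bar>r + s - n\<bar>" and "b = \<bar>r - s\<bar>"
  have even: "even (r + s - a)" "even (r + s - b)" unfolding a_def b_def by presburger+
  have C: "C n j r s = r + s - min a (max b j)" for j by (simp add: C_def a_def b_def)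
  consider "a \<le> k" | "k < a" "k < b" | "k < a" "b \<le> k" by linarith
  then show ?thesis
  proof cases
    case 1
    then show ?thesis using even unfolding G_def C by simp
  next
    case 2
    then show ?thesis using even unfolding G_def C by (simp add: min_def)
  next
    case 3
    then have "C n k r s = r + s - k" "C n (k+1) r s = r + s - (k + 1)" unfolding C by auto
    then show ?thesis unfolding G_def by simp
  qed
qed

lemma G_gap: "G n (k - 1) r s - G n k r s = C n (k - 1) r s mod 2"
proof -
  have "G n k r s = C n (k - 1) r s div 2" using C_div_2[of n "k - 1" r s] by simp
  moreover have "G n (k - 1) r s = (C n (k - 1) r s + 1) div 2" by (simp add: G_def)
  ultimately show ?thesis by presburger
qed

text \<open>The reflection sends \<open>C\<close> to \<open>2 * s - C n (n - k) r s\<close>. The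
  sign turns rounding up into rounding down, and \<open>C_div_2\<close> turns this back at one level
  higher.\<close>

lemma G_flip:
  assumes "0 \<le> r" "r \<le> n" "0 \<le> s" "s \<le> n"
  shows "s - G n k (n - r) s = G n (n + 1 - k) r s"
proof -
  have "C n k (n - r) s = 2 * s - C n (n - k) r s"
    unfolding C_def using assms by (smt (verit))
  then have "s - G n k (n - r) s = C n (n - k) r s div 2"
    unfolding G_def by presburger
  then show ?thesis by (simp add: C_div_2 algebra_simps)
qed

lemma G_step_left:
  assumes "r \<le> r'"
  shows "G n k r s \<le> G n k r' s" "G n k r' s \<le> G n k r s + (r' - r)"
proof -
  have "C n k r s \<le> C n k r' s" "C n k r' s \<le> C n k r s + 2 * (r' - r)"
    using assms unfolding C_def by (smt (verit))+
  then show "G n k r s \<le> G n k r' s" "G n k r' s \<le> G n k r s + (r' - r)"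
    unfolding G_def by presburger+
qed

section \<open>The 2-increasing property of \<open>C\<close> and lower bounds for volumes of
  \<open>G\<close>\<close>

lemma C_cell: "0 \<le> C n k r s + C n k (r+1) (s+1) - C n k r (s+1) - C n k (r+1) s"
proof -
  define p where "p u = n - \<bar>u - n\<bar>" for u :: int
  define q where "q v = max \<bar>v\<bar> k" for v :: int
  define u v where "u = r + s" and "v = r - s"
  \<comment> \<open>Concavity of \<open>p\<close> settles the final inequality if both minima on its
    right pick \<open>p\<close>, convexity of \<open>q\<close> if both pick \<open>q\<close>. In the
    mixed case one of \<open>p u\<close>, \<open>p (u+2)\<close> is 1 below \<open>p (u+1)\<close>,
    which pays for the unit by which \<open>q\<close> may vary.\<close>
  have p: "p (u+1) = p u + 1 \<or> p (u+1) = p (u+2) + 1" "p u + p (u+2) \<le> 2 * p (u+1)"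
    unfolding p_def by (smt (verit))+
  have q: "\<bar>q (v+1) - q v\<bar> \<le> 1" "\<bar>q (v-1) - q v\<bar> \<le> 1" "2 * q v \<le> q (v+1) + q (v-1)"
    unfolding q_def by linarith+
  have "C n k r s = u - min (p u) (q v)" "C n k (r+1) (s+1) = u + 2 - min (p (u+2)) (q v)"
    "C n k r (s+1) = u + 1 - min (p (u+1)) (q (v-1))"
    "C n k (r+1) s = u + 1 - min (p (u+1)) (q (v+1))"
    unfolding C_def p_def q_def u_def v_def by (simp_all add: algebra_simps)
  moreover have "min (p u) (q v) + min (p (u+2)) (q v) \<le> min (p (u+1)) (q (v-1)) + min (p (u+1)) (q (v+1))"
    using p q unfolding min_def by (smt (verit))
  ultimately show ?thesis by linarith
qed

lemma two_increasing_of_cells: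
  fixes f :: "int \<Rightarrow> int \<Rightarrow> int"
  assumes cell: "\<And>r s. 0 \<le> f r s + f (r+1) (s+1) - f r (s+1) - f (r+1) s"
    and "r \<le> r'" "s \<le> s'"
  shows "0 \<le> f r s + f r' s' - f r s' - f r' s"
proof -
  have strip: "0 \<le> f r s + f (r+1) s' - f r s' - f (r+1) s" for r
    using \<open>s \<le> s'\<close>
  proof (induction s' rule: int_ge_induct)
    case (step t)
    then show ?case using cell[of r t] by simp
  qed simp
  show ?thesis using \<open>r \<le> r'\<close>
  proof (induction r' rule: int_ge_induct)
    case (step t)
    then show ?case using strip[of t] by simp
  qed simp
qed

text \<open>The other two candidates, twice the Frechet bounds, are even, so an odd value forces
  \<open>k\<close> to be selected strictly.\<close>

lemma C_odd:
  assumes "odd (C n k r s)"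
  shows "C n k r s = r + s - k" "\<bar>r - s\<bar> < k" "\<bar>r + s - n\<bar> < n - k"
proof -
  define a where "a = n - \<bar>r + s - n\<bar>"
  have C: "C n k r s = r + s - min a (max \<bar>r - s\<bar> k)" by (simp add: C_def a_def)
  have "even (r + s - a)" "even (r + s - \<bar>r - s\<bar>)" unfolding a_def by presburger+
  then have "\<bar>r - s\<bar> < k \<and> k < a" using assms unfolding C min_def max_def
    by (smt (verit))
  then show "C n k r s = r + s - k" "\<bar>r - s\<bar> < k" "\<bar>r + s - n\<bar> < n - k"
    unfolding C a_def by auto
qed

text \<open>By \<open>G_gap\<close> the left side is 0 or -1, and rounding costs at most 1, so only
  volume -1 against the bound 0 has to be excluded. There the off-diagonal corners lie in the band
  where \<open>k\<close> is selected, which puts \<open>(r, s)\<close> in the band too or on the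
  zero plateau below it.\<close>

lemma G_vol_SE:
  assumes "r \<le> r'" "s \<le> s'"
  shows "G n k r s - G n (k-1) r s \<le> G n k r s + G n k r' s' - G n k r s' - G n k r' s"
proof (rule ccontr)
  let ?c = "C n k"
  have V: "0 \<le> ?c r s + ?c r' s' - ?c r s' - ?c r' s"
    by (rule two_increasing_of_cells[of "C n k", OF C_cell assms])
  assume "\<not> ?thesis"
  then have lt: "G n k r s + G n k r' s' - G n k r s' - G n k r' s < - (C n (k-1) r s mod 2)"
    using G_gap[of n k r s] by linarith
  then have "G n k r s + G n k r' s' - G n k r s' - G n k r' s < 0"
    by (smt (verit) pos_mod_sign)
  \<comment> \<open>Negative volume needs vanishing \<open>C\<close>-volume and rounding up at both off-diagonal corners only.\<close>
  then have odd: "odd (?c r s')" "odd (?c r' s)" and even: "even (?c r s)"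
    and V0: "?c r s + ?c r' s' = ?c r s' + ?c r' s"
    using V unfolding G_def by presburger+
  have "-1 \<le> G n k r s + G n k r' s' - G n k r s' - G n k r' s"
    using V unfolding G_def by presburger
  then have same: "even (C n (k-1) r s)" using lt by presburger
  note bounds = C_odd(2,3)[OF odd(1)] C_odd(2,3)[OF odd(2)]
  have v: "\<bar>r - s\<bar> < k" using bounds assms by linarith
  show False
  proof (cases "k \<le> r + s")
    case True
    have u: "k \<le> n - \<bar>r + s - n\<bar>" using True bounds assms by linarith
    have "?c r s = r + s - k" "C n (k-1) r s = r + s - (k-1)"
      using u v by (auto simp: C_def)
    then show False using even same by presburger
  next
    case False
    have "?c r s = 0" using False bounds assms v by (auto simp: C_def)
    \<comment> \<open>The vanishing volume puts \<open>C\<close> at \<open>(r', s')\<close> below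
      \<open>r' + s' - k\<close>, which is a lower bound since \<open>|r' - s'| < k\<close>.\<close>
    then have "?c r' s' = r + s + r' + s' - 2 * k"
      using V0 C_odd(1)[OF odd(1)] C_odd(1)[OF odd(2)] by linarith
    moreover have "r' + s' - max \<bar>r' - s'\<bar> k \<le> ?c r' s'" by (simp add: C_def)
    ultimately show False using False bounds assms by linarith
  qed
qed

text \<open>The half-turn of \<open>G_reflect\<close> swaps the diagonal corners; the affine term it
  adds has zero volume and does not depend on \<open>k\<close>.\<close>

lemma G_vol_NW:
  assumes "r \<le> r'" "s \<le> s'"
  shows "G n k r' s' - G n (k-1) r' s' \<le> G n k r s + G n k r' s' - G n k r s' - G n k r' s"
  using G_vol_SE[of "n - r'" "n - r" "n - s'" "n - s" n k] assms
  by (simp add: G_reflect)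

section \<open>Regions of \<open>G\<close>, unit cells and the matrices \<open>F\<close>\<close>

lemma G_outer:
  assumes "n - \<bar>r + s - n\<bar> \<le> k"
  shows "G n k r s = max 0 (r + s - n)"
proof -
  have "C n k r s = 2 * max 0 (r + s - n)" using assms unfolding C_def by (smt (verit))
  then show ?thesis unfolding G_def by presburger
qed

text \<open>The threshold is \<open>k - 1\<close> because \<open>G\<close> at level \<open>k\<close>
  is also the lower rounding of \<open>C\<close> at level \<open>k - 1\<close>.\<close>

lemma G_side:
  assumes "0 \<le> r" "r \<le> n" "0 \<le> s" "s \<le> n" "k - 1 \<le> \<bar>r - s\<bar>"
  shows "G n k r s = min r s"
proof -
  have "C n (k - 1) r s = 2 * min r s" using assms unfolding C_def by auto
  then show ?thesis using C_div_2[of n "k - 1" r s] by simp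
qed

text \<open>The region is wide enough to contain all four corners of each cell in the support of
  \<open>F\<close>.\<close>

lemma G_inner:
  assumes "\<bar>r - s\<bar> \<le> k" "k - 1 \<le> r + s" "r + s \<le> 2 * n - k + 1"
  shows "G n k r s = (r + s - k + 1) div 2"
proof (cases "k \<le> n - \<bar>r + s - n\<bar>")
  case True
  then show ?thesis using assms unfolding G_def C_def by auto
next
  case False
  \<comment> \<open>On this extra layer \<open>C\<close> is larger by 1, but even, so the rounding
    absorbs the difference.\<close>
  then have edge: "n - \<bar>r + s - n\<bar> = k - 1" using assms by linarith
  then have "C n k r s = r + s - (k - 1)" using assms unfolding C_def by auto
  moreover have "even (r + s - (n - \<bar>r + s - n\<bar>))" by presburger
  ultimately show ?thesis using edge unfolding G_def by presburger
qed

text \<open>In the first three cases \<open>G\<close> is a Frechet bound on the cell, away from its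
  ridge, so there is no mass. In the last the corners lie on three consecutive antidiagonals, and
  the second difference of a rounded half alternates in sign.\<close>

lemma G_cell:
  assumes k: "1 \<le> k" "k \<le> n" and rs: "1 \<le> r" "r \<le> n" "1 \<le> s" "s \<le> n"
  shows "G n k r s + G n k (r-1) (s-1) - G n k r (s-1) - G n k (r-1) s =
    (if k + 1 \<le> r + s \<and> r + s \<le> 2 * n - k + 1 \<and> \<bar>r - s\<bar> \<le> k - 1
     then if even (r + s - k - 1) then 1 else -1 else 0)"
proof -
  consider "r + s \<le> k" | "2 * n - k + 2 \<le> r + s" | "k \<le> \<bar>r - s\<bar>"
    | "k + 1 \<le> r + s" "r + s \<le> 2 * n - k + 1" "\<bar>r - s\<bar> \<le> k - 1" by linarith
  then show ?thesis
  proof cases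
    case 1
    then show ?thesis using k by (simp add: G_outer)
  next
    case 2
    then show ?thesis using k by (simp add: G_outer)
  next
    case 3
    then show ?thesis using rs k by (auto simp: G_side abs_if split: if_splits)
  next
    case 4
    define t where "t = r + s - k"
    have "G n k r s = (t + 1) div 2" "G n k (r-1) (s-1) = (t - 1) div 2"
      "G n k (r-1) s = t div 2" "G n k r (s-1) = t div 2"
      using 4 G_inner[of r s k n] G_inner[of "r-1" "s-1" k n] G_inner[of "r-1" s k n] G_inner[of r "s-1" k n]
      by (simp_all add: t_def algebra_simps)
    moreover have "(t + 1) div 2 + (t - 1) div 2 - t div 2 - t div 2 = (if even (t - 1) then 1 else -1)"
      by presburger
    ultimately show ?thesis using 4 by (simp add: t_def)
  qed
qed

lemma F_eq_cell:
  assumes "1 \<le> k" "k \<le> n" "i \<in> {1..n}" "j \<in> {1..n}"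
  shows "F n k i j = G n k i j + G n k (int i - 1) (int j - 1) - G n k i (int j - 1) - G n k (int i - 1) j"
proof -
  have "even (i + j - k - 1) \<longleftrightarrow> even (int i + int j - int k - 1)" if "k + 1 \<le> i + j"
    using that by presburger
  then show ?thesis
    using G_cell[of "int k" "int n" "int i" "int j"] assms
    unfolding F_def by (auto simp: minus_one_power_iff)
qed

lemma F_commute: "F n k i j = F n k j i"
  by (simp add: F_def add.commute abs_minus_commute)

lemma F_row_sum:
  assumes "1 \<le> k" "k \<le> n" "i \<in> {1..n}" "m \<le> n"
  shows "(\<Sum>j=1..m. F n k i j) = G n k i m - G n k (int i - 1) m"
  using \<open>m \<le> n\<close>
proof (induction m)
  case 0
  have "G n k i 0 = 0" "G n k (int i - 1) 0 = 0"
    using assms by (simp_all add: G_0_right)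
  then show ?case by simp
next
  case (Suc m)
  then show ?case using F_eq_cell[of k n i "Suc m"] assms by simp
qed

text \<open>Cell masses telescope in both directions from the zero boundary of
  \<open>G\<close>.\<close>

lemma Q_of_F:
  assumes k: "1 \<le> k" "k \<le> n" and "r \<le> n" "s \<le> n"
  shows "Q_of (F n k) r s = G n k r s"
proof -
  have "(\<Sum>i=1..r. \<Sum>j=1..s. F n k i j) = G n k r s"
    using \<open>r \<le> n\<close>
  proof (induction r)
    case 0
    then show ?case using \<open>s \<le> n\<close> by (simp add: G_0_left)
  next
    case (Suc r)
    then show ?case using F_row_sum[of k n "Suc r" s] assms by simp
  qed
  then show ?thesis by (simp add: Q_of_def)
qed

text \<open>By \<open>F_row_sum\<close> a partial row sum is the increment of \<open>G\<close> over
  one row, so \<open>G_step_left\<close> bounds it; symmetry of \<open>F\<close> handles the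
  columns.\<close>

lemma ASM_F:
  assumes k: "1 \<le> k" "k \<le> n"
  shows "ASM n (F n k)"
proof -
  have entries: "F n k i j \<in> {-1, 0, 1}" for i j
    by (auto simp: F_def minus_one_power_iff)
  have partial: "(\<Sum>j=1..m. F n k i j) \<in> {0..1}" if "i \<in> {1..n}" "m \<in> {1..n}" for i m
    using F_row_sum[of k n i m] G_step_left[of "int i - 1" i n k m] that k by auto
  have total: "(\<Sum>j=1..n. F n k i j) = 1" if "i \<in> {1..n}" for i
    using F_row_sum[of k n i n] that k by (simp add: G_n_right)
  have column: "(\<Sum>i=1..m. F n k i j) = (\<Sum>i=1..m. F n k j i)" for j m
    by (intro sum.cong refl F_commute)
  show ?thesis
    unfolding ASM_def column using entries partial total by blast
qed

lemma vol_F: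
  assumes "1 \<le> k" "k \<le> n" "i \<le> n" "j \<le> n" "c \<le> n" "d \<le> n"
  shows "vol (Q_of (F n k)) i j c d = real_of_int (G n k i c + G n k j d - G n k i d - G n k j c)"
  using assms by (simp add: vol_def Q_of_F)

lemma boundary_F:
  assumes "1 \<le> k" "k \<le> n"
  shows "boundary n (Q_of (F n k))"
  using assms by (simp add: boundary_def L_def Q_of_F G_0_left G_0_right G_n_left G_n_right)

lemma quasi_copula_F:
  assumes k: "1 \<le> k" "k \<le> n"
  shows "discrete_quasi_copula n (Q_of (F n k))"
proof -
  let ?Q = "Q_of (F n k)"
  have left: "?Q r s \<le> ?Q r' s" "?Q r' s \<le> ?Q r s + (real r' - real r)"
    if "r \<le> r'" "r' \<le> n" "s \<le> n" for r r' s
    using G_step_left[of "int r" "int r'" n k s] that k by (simp_all add: Q_of_F)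
  have sym: "?Q r s = ?Q s r" if "r \<le> n" "s \<le> n" for r s
    using that k by (simp add: Q_of_F G_commute[of n k "int r"])
  have right: "?Q r s \<le> ?Q r s'" "?Q r s' \<le> ?Q r s + (real s' - real s)"
    if "s \<le> s'" "s' \<le> n" "r \<le> n" for r s s'
    using left[of s s' r] sym[of r s] sym[of r s'] that by simp_all
  have bnd: "?Q 0 s = 0" "?Q n s = real s" if "s \<le> n" for s
    using boundary_F[OF k] that by (auto simp: boundary_def L_def)
  have grid: "0 \<le> ?Q r s \<and> ?Q r s \<le> real n" if "r \<le> n" "s \<le> n" for r s
    using left(1)[of 0 r s] left(1)[of r n s] bnd[of s] that by auto
  have lip: "\<bar>?Q r2 s2 - ?Q r1 s1\<bar> \<le> \<bar>real r2 - real r1\<bar> + \<bar>real s2 - real s1\<bar>"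
    if "r1 \<le> n" "r2 \<le> n" "s1 \<le> n" "s2 \<le> n" for r1 r2 s1 s2
  proof -
    have "\<bar>?Q r2 s1 - ?Q r1 s1\<bar> \<le> \<bar>real r2 - real r1\<bar>"
      using left[of r1 r2 s1] left[of r2 r1 s1] that by (cases "r1 \<le> r2") auto
    moreover have "\<bar>?Q r2 s2 - ?Q r2 s1\<bar> \<le> \<bar>real s2 - real s1\<bar>"
      using right[of s1 s2 r2] right[of s2 s1 r2] that by (cases "s1 \<le> s2") auto
    ultimately show ?thesis by linarith
  qed
  show ?thesis
    unfolding discrete_quasi_copula_def grid_function_def L_def
    using boundary_F[OF k] grid lip left(1) right(1) by simp
qed

lemma proper_F:
  assumes k: "2 \<le> k" "k < n"
  shows "proper_quasi_copula n (Q_of (F n k))"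
proof -
  \<comment> \<open>This is the cell of the entry in row 2 and column \<open>k\<close>, which is
    -1.\<close>
  have "vol (Q_of (F n k)) 1 2 (k - 1) k = -1"
    using G_cell[of "int k" "int n" 2 "int k"] k by (simp add: vol_F of_nat_diff)
  then have "\<exists>i j c d. i \<le> j \<and> j \<le> n \<and> c \<le> d \<and> d \<le> n \<and> vol (Q_of (F n k)) i j c d < 0"
    using k by (intro exI[of _ 1] exI[of _ 2] exI[of _ "k - 1"] exI[of _ k]) auto
  then show ?thesis
    using quasi_copula_F[of k n] k by (simp add: proper_quasi_copula_def)
qed

section \<open>Defects of \<open>Q_of (F n k)\<close> and the operator \<open>Q_M\<close>\<close>

lemma D_SE_le:
  assumes "r \<le> r'" "r' \<le> n" "s \<le> s'" "s' \<le> n"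
  shows "D_SE n Q r s \<le> vol Q r r' s s'"
  unfolding D_SE_def by (rule Min_le) (use assms in force)+

lemma D_NW_le:
  assumes "r' \<le> r" "s' \<le> s"
  shows "D_NW n Q r s \<le> vol Q r' r s' s"
  unfolding D_NW_def by (rule Min_le) (use assms in force)+

lemma D_SW_le:
  assumes "r \<le> r'" "r' \<le> n" "s' \<le> s"
  shows "D_SW n Q r s \<le> vol Q r r' s' s"
  unfolding D_SW_def by (rule Min_le) (use assms in force)+

lemma D_NE_le:
  assumes "r' \<le> r" "s \<le> s'" "s' \<le> n"
  shows "D_NE n Q r s \<le> vol Q r' r s s'"
  unfolding D_NE_def by (rule Min_le) (use assms in force)+

lemma D_SE_ge:
  assumes "r \<le> n" "s \<le> n"
    and "\<And>r' s'. r \<le> r' \<Longrightarrow> r' \<le> n \<Longrightarrow> s \<le> s' \<Longrightarrow> s' \<le> n \<Longrightarrow> x \<le> vol Q r r' s s'"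
  shows "x \<le> D_SE n Q r s"
  unfolding D_SE_def by (rule Min.boundedI) (use assms in auto)

lemma D_NW_ge:
  assumes "\<And>r' s'. r' \<le> r \<Longrightarrow> s' \<le> s \<Longrightarrow> x \<le> vol Q r' r s' s"
  shows "x \<le> D_NW n Q r s"
  unfolding D_NW_def by (rule Min.boundedI) (use assms in auto)

text \<open>\<open>G_vol_SE\<close> and \<open>G_vol_NW\<close> give the lower bound. It is attained
  by a degenerate rectangle if \<open>C\<close> at level \<open>k - 1\<close> is even, and otherwise
  by a unit cell at \<open>(r, s)\<close> with entry -1.\<close>

lemma D_M_F:
  assumes k: "2 \<le> k" "k < n" and rs: "r \<le> n" "s \<le> n"
  shows "D_M n (Q_of (F n k)) r s = - real_of_int (C n (int k - 1) r s mod 2)"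
proof (rule antisym)
  let ?Q = "Q_of (F n k)" and ?c = "C n (int k - 1) r s"
  note gap = G_gap[of n k r s]
  have k': "1 \<le> k" "k \<le> n" using k by auto
  have "- real_of_int (?c mod 2) \<le> D_SE n ?Q r s"
  proof (rule D_SE_ge[OF rs])
    fix r' s' assume le: "r \<le> r'" "r' \<le> n" "s \<le> s'" "s' \<le> n"
    then have "- (?c mod 2) \<le> G n k r s + G n k r' s' - G n k r s' - G n k r' s"
      using G_vol_SE[of r r' s s' n k] gap by linarith
    then show "- real_of_int (?c mod 2) \<le> vol ?Q r r' s s'"
      unfolding vol_F[OF k' \<open>r \<le> n\<close> \<open>r' \<le> n\<close> \<open>s \<le> n\<close> \<open>s' \<le> n\<close>] by linarith
  qed
  moreover have "- real_of_int (?c mod 2) \<le> D_NW n ?Q r s"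
  proof (rule D_NW_ge)
    fix r' s' assume le: "r' \<le> r" "s' \<le> s"
    then have le': "r' \<le> n" "s' \<le> n" using rs by auto
    have "- (?c mod 2) \<le> G n k r' s' + G n k r s - G n k r' s - G n k r s'"
      using G_vol_NW[of r' r s' s n k] gap le by linarith
    then show "- real_of_int (?c mod 2) \<le> vol ?Q r' r s' s"
      unfolding vol_F[OF k' \<open>r' \<le> n\<close> \<open>r \<le> n\<close> \<open>s' \<le> n\<close> \<open>s \<le> n\<close>] by linarith
  qed
  ultimately show "- real_of_int (?c mod 2) \<le> D_M n ?Q r s" by (simp add: D_M_def)
  show "D_M n ?Q r s \<le> - real_of_int (?c mod 2)"
  proof (cases "even ?c")
    case True
    have "D_NW n ?Q r s \<le> vol ?Q r r s s" by (rule D_NW_le) auto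
    then show ?thesis using True by (simp add: D_M_def vol_def)
  next
    case False
    note odd = C_odd[OF False]
    have parity: "even (int r + int s - int k)" using False odd(1) by presburger
    show ?thesis
    \<comment> \<open>The south-east cell holds the entry at \<open>(r + 1, s + 1)\<close>, which is
      in the support of \<open>F\<close> only before this antidiagonal; from there on the north-west
      cell, with the entry at \<open>(r, s)\<close>, is used.\<close>
    proof (cases "r + s < 2 * n - k")
      case True
      have "r + 1 \<le> n" "s + 1 \<le> n" using True odd(2,3) k by linarith+
      moreover have "k + 1 \<le> (int r + 1) + (int s + 1)" "(int r + 1) + (int s + 1) \<le> 2 * int n - k + 1"
        "\<bar>(int r + 1) - (int s + 1)\<bar> \<le> int k - 1"
        using True odd(2,3) k by linarith+
      moreover have "odd ((int r + 1) + (int s + 1) - k - 1)" using parity by presburger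
      moreover from calculation have "vol ?Q r (r+1) s (s+1) = -1"
        using G_cell[of "int k" "int n" "int r + 1" "int s + 1"] k
        by (simp add: vol_F add.commute)
      ultimately have "D_SE n ?Q r s \<le> -1" using D_SE_le[of r "r+1" n s "s+1" ?Q] by simp
      then show ?thesis using False by (simp add: D_M_def odd_iff_mod_2_eq_one)
    next
      case outside: False
      have "1 \<le> r" "1 \<le> s" using outside odd(2,3) k by linarith+
      moreover have "k + 1 \<le> int r + int s" "int r + int s \<le> 2 * int n - k + 1"
        "\<bar>int r - int s\<bar> \<le> int k - 1"
        using outside odd(2,3) k rs by linarith+
      moreover have "odd (int r + int s - k - 1)" using parity by presburger
      moreover from calculation have "vol ?Q (r-1) r (s-1) s = -1"
        using G_cell[of "int k" "int n" "int r" "int s"] k rs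
        by (simp add: vol_F of_nat_diff)
      ultimately have "D_NW n ?Q r s \<le> -1" using D_NW_le[of "r-1" r "s-1" s n ?Q] by simp
      then show ?thesis using False by (simp add: D_M_def odd_iff_mod_2_eq_one)
    qed
  qed
qed

lemma Q_M_F:
  assumes k: "2 \<le> k" "k < n"
  shows "grid_eq n (Q_M n (Q_of (F n k))) (Q_of (F n (k - 1)))"
  unfolding grid_eq_def L_def
proof (intro ballI)
  fix r s assume "r \<in> {0..n}" "s \<in> {0..n}"
  then have rs: "r \<le> n" "s \<le> n" by auto
  have "real_of_int (G n (int k - 1) r s) = G n k r s + real_of_int (C n (int k - 1) r s mod 2)"
    using G_gap[of n k r s] by linarith
  then show "Q_M n (Q_of (F n k)) r s = Q_of (F n (k - 1)) r s"
    using k rs by (simp add: Q_M_def D_M_F Q_of_F of_nat_diff)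
qed

section \<open>Reflection of the grid and the operator \<open>Q_O\<close>\<close>

definition flip :: "nat \<Rightarrow> (nat \<Rightarrow> nat \<Rightarrow> real) \<Rightarrow> nat \<Rightarrow> nat \<Rightarrow> real" where
  "flip n Q r s = real s - Q (n - r) s"

lemma vol_flip: "vol (flip n Q) i j c d = vol Q (n - j) (n - i) c d"
  by (simp add: vol_def flip_def)

text \<open>Reversing the rows exchanges south and north, so south-west rectangles become north-west
  and north-east ones south-east.\<close>

lemma D_O_flip:
  assumes "r \<le> n"
  shows "D_O n Q r s = D_M n (flip n Q) (n - r) s"
proof -
  have image: "{r..n} \<times> {0..s} = (\<lambda>(a, b). (n - a, b)) ` ({0..n-r} \<times> {0..s})"
    "{0..r} \<times> {s..n} = (\<lambda>(a, b). (n - a, b)) ` ({n-r..n} \<times> {s..n})"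
  proof -
    have "x \<in> (\<lambda>a. n - a) ` {0..n-r}" if "x \<in> {r..n}" for x
      using that by (intro image_eqI[of _ _ "n - x"]) auto
    moreover have "x \<in> (\<lambda>a. n - a) ` {n-r..n}" if "x \<in> {0..r}" for x
      using that assms by (intro image_eqI[of _ _ "n - x"]) auto
    ultimately have "{r..n} = (\<lambda>a. n - a) ` {0..n-r}" "{0..r} = (\<lambda>a. n - a) ` {n-r..n}"
      using assms by auto
    then show "{r..n} \<times> {0..s} = (\<lambda>(a, b). (n - a, b)) ` ({0..n-r} \<times> {0..s})"
      "{0..r} \<times> {s..n} = (\<lambda>(a, b). (n - a, b)) ` ({n-r..n} \<times> {s..n})"
      by force+
  qed
  show ?thesis
    unfolding D_O_def D_M_def D_SW_def D_NE_def D_SE_def D_NW_def image image_image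
    using assms by (simp add: vol_flip case_prod_unfold min.commute)
qed

lemma Q_O_flip:
  assumes "r \<le> n"
  shows "Q_O n Q r s = flip n (Q_M n (flip n Q)) r s"
  using assms by (simp add: Q_O_def Q_M_def D_O_flip flip_def)

lemma flip_cong: "grid_eq n P Q \<Longrightarrow> grid_eq n (flip n P) (flip n Q)"
  by (simp add: grid_eq_def flip_def L_def)

lemma grid_eq_trans: "grid_eq n P Q \<Longrightarrow> grid_eq n Q R \<Longrightarrow> grid_eq n P R"
  by (simp add: grid_eq_def)

lemma grid_eq_sym: "grid_eq n P Q \<Longrightarrow> grid_eq n Q P"
  by (simp add: grid_eq_def)

lemma vol_cong:
  assumes "grid_eq n P Q" "i \<le> n" "j \<le> n" "c \<le> n" "d \<le> n"
  shows "vol P i j c d = vol Q i j c d"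
  using assms by (simp add: vol_def grid_eq_def L_def)

lemma Q_M_cong:
  assumes "grid_eq n P Q"
  shows "grid_eq n (Q_M n P) (Q_M n Q)"
  unfolding grid_eq_def L_def
proof (intro ballI)
  fix r s assume "r \<in> {0..n}" "s \<in> {0..n}"
  then have rs: "r \<le> n" "s \<le> n" by auto
  have "D_SE n P r s = D_SE n Q r s" "D_NW n P r s = D_NW n Q r s"
    unfolding D_SE_def D_NW_def
    using vol_cong[OF assms] rs by (auto intro!: arg_cong[of _ _ Min] image_cong)
  then show "Q_M n P r s = Q_M n Q r s"
    using assms rs by (simp add: Q_M_def D_M_def grid_eq_def L_def)
qed

lemma Q_O_cong:
  assumes "grid_eq n P Q"
  shows "grid_eq n (Q_O n P) (Q_O n Q)"
proof -
  have "grid_eq n (Q_O n R) (flip n (Q_M n (flip n R)))" for R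
    by (simp add: grid_eq_def L_def Q_O_flip)
  then show ?thesis
    using flip_cong[OF Q_M_cong[OF flip_cong[OF assms]]] grid_eq_trans grid_eq_sym by metis
qed

lemma flip_F:
  assumes "1 \<le> k" "k \<le> n"
  shows "grid_eq n (flip n (Q_of (F n k))) (Q_of (F n (n + 1 - k)))"
  unfolding grid_eq_def L_def
proof (intro ballI)
  fix r s assume "r \<in> {0..n}" "s \<in> {0..n}"
  then have rs: "r \<le> n" "s \<le> n" by auto
  have "int s - G n k (int (n - r)) s = G n (int (n + 1 - k)) r s"
    using G_flip[of r n s k] rs assms by (simp add: of_nat_diff add.commute)
  moreover have "Q_of (F n k) (n - r) s = G n k (int (n - r)) s"
    "Q_of (F n (n + 1 - k)) r s = G n (int (n + 1 - k)) r s"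
    by (rule Q_of_F; use rs assms in linarith)+
  ultimately show "flip n (Q_of (F n k)) r s = Q_of (F n (n + 1 - k)) r s"
    unfolding flip_def by linarith
qed

text \<open>The reflection takes level \<open>k\<close> to \<open>n + 1 - k\<close>,
  \<open>Q_M\<close> lowers it to \<open>n - k\<close>, and reflecting back gives
  \<open>k + 1\<close>.\<close>

lemma Q_O_F:
  assumes k: "2 \<le> k" "k < n"
  shows "grid_eq n (Q_O n (Q_of (F n k))) (Q_of (F n (k + 1)))"
proof -
  have "grid_eq n (Q_M n (flip n (Q_of (F n k)))) (Q_of (F n (n - k)))"
    using grid_eq_trans[OF Q_M_cong[OF flip_F] Q_M_F[of "n + 1 - k" n]] k by simp
  then have "grid_eq n (flip n (Q_M n (flip n (Q_of (F n k))))) (Q_of (F n (k + 1)))"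
    using grid_eq_trans[OF flip_cong flip_F[of "n - k" n]] k by simp
  then show ?thesis by (simp add: grid_eq_def L_def Q_O_flip)
qed

section \<open>Self-duality, the Frechet bounds and maximality of the chain\<close>

text \<open>Each mixed inequality is a volume of \<open>P\<close> or \<open>Q\<close> minus the
  defect at one corner, and that defect is a minimum over rectangles including this one. The four
  corners use the four kinds of defect.\<close>

lemma self_dualI:
  assumes P: "proper_quasi_copula n P" and Q: "proper_quasi_copula n Q"
    and M: "grid_eq n (Q_M n P) Q" and O: "grid_eq n (Q_O n Q) P"
  shows "self_dual_imprecise_copula n P Q"
proof -
  have "Q i c + P j d - P i d - P j c \<ge> 0 \<and> P i c + Q j d - P i d - P j c \<ge> 0 \<and>
      Q i c + Q j d - Q i d - P j c \<ge> 0 \<and> Q i c + Q j d - P i d - Q j c \<ge> 0"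
    if le: "i \<le> j" "j \<le> n" "c \<le> d" "d \<le> n" for i j c d
  proof -
    have "i \<le> n" "c \<le> n" using le by auto
    then have "Q i c = P i c - D_M n P i c" "Q j d = P j d - D_M n P j d"
      "P j c = Q j c + D_O n Q j c" "P i d = Q i d + D_O n Q i d"
      using M O le by (simp_all add: grid_eq_def L_def Q_M_def Q_O_def)
    moreover have "D_M n P i c \<le> vol P i j c d" "D_M n P j d \<le> vol P i j c d"
      "D_O n Q j c \<le> vol Q i j c d" "D_O n Q i d \<le> vol Q i j c d"
      using D_SE_le[of i j n c d P] D_NW_le[of i j c d n P] D_NE_le[of i j c d n Q]
        D_SW_le[of i j n c d Q] le by (auto simp: D_M_def D_O_def)
    ultimately show ?thesis unfolding vol_def by linarith
  qed
  moreover have "grid_function n P" "grid_function n Q" "boundary n P" "boundary n Q"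
    using P Q by (simp_all add: proper_quasi_copula_def discrete_quasi_copula_def)
  ultimately show ?thesis
    unfolding self_dual_imprecise_copula_def discrete_imprecise_copula_def
    using assms by blast
qed

text \<open>At level 1 the threshold in \<open>G_side\<close> is 0, so its region is the whole
  grid.\<close>

lemma frechet_M_F: "1 \<le> n \<Longrightarrow> grid_eq n (Q_of (F n 1)) (frechet_M n)"
  by (auto simp: grid_eq_def L_def Q_of_F G_side frechet_M_def min_def)

lemma frechet_W_F: "1 \<le> n \<Longrightarrow> grid_eq n (Q_of (F n n)) (frechet_W n)"
  by (auto simp: grid_eq_def L_def Q_of_F G_outer frechet_W_def max_def)

lemma copula_M: "discrete_copula n (frechet_M n)"
proof -
  have "vol (frechet_M n) i j k l \<ge> 0" if "i \<le> j" "k \<le> l" for i j k l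
    unfolding vol_def frechet_M_def using that by linarith
  then show ?thesis
    by (auto simp: discrete_copula_def grid_function_def boundary_def L_def frechet_M_def)
qed

lemma copula_W: "discrete_copula n (frechet_W n)"
proof -
  have "vol (frechet_W n) i j k l \<ge> 0" if "i \<le> j" "k \<le> l" for i j k l
    unfolding vol_def frechet_W_def using that by linarith
  then show ?thesis
    by (auto simp: discrete_copula_def grid_function_def boundary_def L_def frechet_W_def)
qed

lemma copula_not_proper: "discrete_copula n Q \<Longrightarrow> \<not> proper_quasi_copula n Q"
  unfolding discrete_copula_def proper_quasi_copula_def by (meson not_le)

lemma proper_cong:
  assumes "grid_eq n P Q" "proper_quasi_copula n P"
  shows "proper_quasi_copula n Q"
proof -
  have "P r s = Q r s" if "r \<in> L n" "s \<in> L n" for r s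
    using assms that by (simp add: grid_eq_def)
  moreover have "0 \<in> L n" "n \<in> L n" by (auto simp: L_def)
  ultimately have "discrete_quasi_copula n Q \<longleftrightarrow> discrete_quasi_copula n P"
    by (simp add: discrete_quasi_copula_def grid_function_def boundary_def)
  moreover have "\<exists>i j c d. i \<le> j \<and> j \<le> n \<and> c \<le> d \<and> d \<le> n \<and> vol Q i j c d < 0"
    using assms vol_cong[OF assms(1)] by (metis order_trans proper_quasi_copula_def)
  ultimately show ?thesis using assms by (simp add: proper_quasi_copula_def)
qed

text \<open>If \<open>d = 0\<close>, the longer chain has a member after position \<open>l\<close>,
  so \<open>Q_M\<close> of the last member would be proper. Otherwise it has one before the first,
  and \<open>Q_O\<close> of the first would be proper.\<close>

lemma maximal_chain:
  assumes l: "1 \<le> l" and chain: "self_dual_chain n l Q"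
    and first: "\<not> proper_quasi_copula n (Q_O n (Q 1))"
    and last: "\<not> proper_quasi_copula n (Q_M n (Q l))"
  shows "maximal_self_dual_chain n l Q"
proof -
  have False if "l < l'" "d + l \<le> l'" and chain': "self_dual_chain n l' Q'"
    and eq: "\<And>r. r \<in> {1..l} \<Longrightarrow> grid_eq n (Q' (d + r)) (Q r)" for l' d Q'
  proof (cases "d = 0")
    case True
    have "grid_eq n (Q_M n (Q' l)) (Q' (l + 1))" "proper_quasi_copula n (Q' (l + 1))"
      using chain' l \<open>l < l'\<close> by (auto simp: self_dual_chain_def)
    moreover have "grid_eq n (Q_M n (Q' l)) (Q_M n (Q l))"
      using Q_M_cong[OF eq[of l]] True l by simp
    ultimately show False using last by (blast intro: proper_cong dest: grid_eq_sym)
  next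
    case False
    then have "d + 1 \<in> {2..l'}" "d \<in> {1..l'}" using l \<open>d + l \<le> l'\<close> by auto
    then have "grid_eq n (Q_O n (Q' (d + 1))) (Q' d)" "proper_quasi_copula n (Q' d)"
      using chain' unfolding self_dual_chain_def by (metis add_diff_cancel_right', metis)
    moreover have "grid_eq n (Q_O n (Q' (d + 1))) (Q_O n (Q 1))"
      using Q_O_cong[OF eq[of 1]] l by simp
    ultimately show False using first by (blast intro: proper_cong dest: grid_eq_sym)
  qed
  then show ?thesis using chain unfolding maximal_self_dual_chain_def by blast
qed

lemma self_dual_F:
  assumes "3 \<le> k" "k < n"
  shows "self_dual_imprecise_copula n (Q_of (F n k)) (Q_of (F n (k - 1)))"
  using proper_F[of k n] proper_F[of "k - 1" n] Q_M_F[of k n] Q_O_F[of "k - 1" n] assms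
  by (intro self_dualI) auto

theorem corollary4p9:
  fixes n :: nat
  assumes "n \<ge> 4"
  shows "(\<forall>k. 3 \<le> k \<and> k \<le> n - 1 \<longrightarrow> dual_pair n (F n k) (F n (k - 1))) \<and>
    (let l = n - 2; Q = (\<lambda>r. Q_of (F n (n - r))) in
       (\<forall>r\<in>{1..<l}. self_dual_imprecise_copula n (Q r) (Q (r + 1))) \<and>
       maximal_self_dual_chain n l Q) \<and>
    grid_eq n (Q_O n (Q_of (F n (n - 1)))) (frechet_W n) \<and>
    grid_eq n (Q_M n (Q_of (F n 2))) (frechet_M n) \<and>
    discrete_copula n (frechet_W n) \<and> \<not> proper_quasi_copula n (frechet_W n) \<and>
    discrete_copula n (frechet_M n) \<and> \<not> proper_quasi_copula n (frechet_M n)"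
proof -
  \<comment> \<open>Position \<open>r\<close> is level \<open>n - r\<close>: \<open>Q_O\<close>
    raises the level and moves left in the chain, \<open>Q_M\<close> moves right.\<close>
  define Q where "Q r = Q_of (F n (n - r))" for r
  have dual: "dual_pair n (F n k) (F n (k - 1))" if "3 \<le> k \<and> k \<le> n - 1" for k
    unfolding dual_pair_def
  proof (intro conjI ASM_F self_dual_F)
  qed (use that assms in linarith)+
  have sd: "self_dual_imprecise_copula n (Q r) (Q (r + 1))" if "r \<in> {1..<n-2}" for r
  proof -
    have "3 \<le> n - r" "n - r < n" using that by auto
    then show ?thesis using self_dual_F[of "n - r" n] by (simp add: Q_def)
  qed
  have W: "grid_eq n (Q_O n (Q_of (F n (n - 1)))) (frechet_W n)"
    using grid_eq_trans[OF _ frechet_W_F] Q_O_F[of "n - 1" n] assms by simp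
  have M: "grid_eq n (Q_M n (Q_of (F n 2))) (frechet_M n)"
    using grid_eq_trans[OF _ frechet_M_F] Q_M_F[of 2 n] assms by simp
  note not_proper = copula_not_proper[OF copula_W, of n] copula_not_proper[OF copula_M, of n]
  have "self_dual_chain n (n - 2) Q"
    unfolding self_dual_chain_def
  proof (intro conjI ballI)
    fix r assume "r \<in> {1..n-2}"
    then show "proper_quasi_copula n (Q r)" unfolding Q_def by (intro proper_F) auto
  next
    fix r assume r: "r \<in> {2..n-2}"
    then have "n - (r - 1) = n - r + 1" "2 \<le> n - r" "n - r < n" by auto
    then show "grid_eq n (Q_O n (Q r)) (Q (r - 1))"
      using Q_O_F[of "n - r" n] by (simp add: Q_def)
  next
    fix r assume "r \<in> {1..<n-2}"
    then have "2 \<le> n - r" "n - r < n" by auto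
    then show "grid_eq n (Q_M n (Q r)) (Q (r + 1))"
      using Q_M_F[of "n - r" n] by (simp add: Q_def)
  qed
  moreover have "\<not> proper_quasi_copula n (Q_O n (Q 1))"
    using W not_proper(1) proper_cong by (auto simp: Q_def)
  moreover have "\<not> proper_quasi_copula n (Q_M n (Q (n - 2)))"
    using M not_proper(2) proper_cong assms by (auto simp: Q_def)
  ultimately have "maximal_self_dual_chain n (n - 2) Q"
    using assms by (intro maximal_chain) auto
  then show ?thesis
    using dual sd W M copula_W copula_M not_proper unfolding Let_def Q_def by blast
qed

end
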